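(* Assume that $(\lambda_s,\mu_s)=(\lambda_m,\mu_m)$ and $(\mathbf f_s,\mathbf f_m)=(0,0)$. If $\mathbf q_m$ and $\mathbf q_s$ are linear vector functions with the same analytic representation, then, writing $\mathbf q_i^h$ for $\mathbf q_i$ as a piecewise linear finite element function on $\Omega_{i,h}$ ($i=s,m$), the pair $(\mathbf q_s^h,\mathbf q_m^h)$ is a solution of the following discrete coupled problem: seek $(\mathbf u_s^h,\mathbf u_m^h)\in\mathbf V^h_s\times\mathbf V^h_m$ such that $$ \begin{aligned} a^h_s(\mathbf u_s^h,\mathbf v_s^h)&=\langle\mathbf f_s,\mathbf v_s^h\rangle_{\Omega_{s,h}} &&\forall\,\mathbf v_s^h\in\mathbf V^h_{s,0},\\ \langle E_{sm}\mathbf u_s^h-\mathbf u_m^h(\hat{\mathbf x}_m),\mathbf w_s^h\rangle_{\Gamma^c_{s,h}}&=0 &&\forall\,\mathbf w_s^h\in\mathbf W^h_s,\\ a^h_m(\mathbf u_m^h,\mathbf v_m^h)-\langle\overline\sigma_s(\mathbf u_s^h)\mathbf n_m,\mathbf v_m^h\rangle_{\Gamma^c_{m,h}}&=\langle\mathbf f_m,\mathbf v_m^h\rangle_{\Omega_{m,h}} &&\forall\,\mathbf v_m^h\in\mathbf V^h_m. \end{aligned} $$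
   Context: Geometry. $\Omega_s,\Omega_m\subset\mathbb R^2$ are domains (simply connected, bounded, with Lipschitz continuous boundary) whose boundaries intersect in a simply connected curve $\Gamma^c=\partial\Omega_s\cap\partial\Omega_m$. For $i=s,m$, $\Omega_{i,h}$ is a triangulation of $\Omega_i$ with mesh size $h_i$, and $h=\max\{h_s,h_m\}$. $\Gamma^c_{i,h}$ is the discretization of $\Gamma^c$ that belongs to $\partial\Omega_{i,h}$, and $\Gamma_{i,h}=\partial\Omega_{i,h}\setminus\Gamma^c_{i,h}$. The discrete interfaces $\Gamma^c_{s,h}$ and $\Gamma^c_{m,h}$ need not coincide in space. $\mathbf n_m$ is the outward unit normal on the boundary of the subdomain with index $m$. It is assumed that there are mappings $\phi_{sm}:\Gamma^c_{s,h}\to\Gamma^c_{m,h}$ and $\phi_{ms}:\Gamma^c_{m,h}\to\Gamma^c_{s,h}$ with $\sup_{\mathbf x_s\in\Gamma^c_{s,h}}d(\mathbf x_s,\phi_{sm}(\mathbf x_s))\le Ch$ and $\sup_{\mathbf x_m\in\Gamma^c_{m,h}}d(\mathbf x_m,\phi_{ms}(\mathbf x_m))\le Ch$ for a constant $C$. Write $\hat{\mathbf x}_m=\phi_{sm}(\mathbf x_s)$ (a function of $\mathbf x_s\in\Gamma^c_{s,h}$) and $\hat{\mathbf x}_s=\phi_{ms}(\mathbf x_m)$ (a function of $\mathbf x_m\in\Gamma^c_{m,h}$). Spaces. $V^h_i\subset\{v\in H^1(\Omega_{i,h}): v=0\text{ on }\Gamma_{i,h}\}$ is the standard piecewise linear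 finite element space on the triangulation; $V^h_{i,0}=\{v\in V^h_i: v=0\text{ on }\partial\Omega_{i,h}\}$; $W^h_i\subset H^{1/2}_{00}(\Gamma^c_{i,h})$ is the piecewise linear space on $\Gamma^c_{i,h}$. $\mathbf V^h_i=(V^h_i)^2$, $\mathbf V^h_{i,0}=(V^h_{i,0})^2$, $\mathbf W^h_i=(W^h_i)^2$. Elasticity. $\lambda_i,\mu_i$ are the Lamé parameters and $\mathbf f_i$ the external force on subdomain $i$; $\varepsilon(\mathbf u)=\tfrac12(\nabla\mathbf u+(\nabla\mathbf u)^T)$; $\sigma_i(\mathbf u)=\lambda_i\,\mathrm{tr}(\varepsilon(\mathbf u))\,\mathbf I+2\mu_i\,\varepsilon(\mathbf u)$; $a^h_i(\mathbf v,\mathbf w)=\int_{\Omega_{i,h}}\sigma_i(\mathbf v):\varepsilon(\mathbf w)\,dx$; $\langle\cdot,\cdot\rangle_D$ is the standard duality pairing with the integral taken over $D$. Taylor expansion operators. $E_{sm}:\mathbf V^h_s\to\mathbf W^h_s$ is defined by $E_{sm}\mathbf v(\mathbf x_s)=\mathbf v(\mathbf x_s)+\nabla\mathbf v(\mathbf x_s)(\hat{\mathbf x}_m-\mathbf x_s)$ for $\mathbf x_s\in\Gamma^c_{s,h}$. $\mathbf E_{sm}:(\mathbf V^h_s)^2\to(\mathbf V^h_m)^2$ is defined, for a rank two tensor $J\in(\mathbf V^h_s)^2$ and $\mathbf x_m\in\Gamma^c_{m,h}$, by $$\mathbf E_{sm}J(\mathbf x_m)=J(\hat{\mathbf x}_s)+\bigl[\,\partial_xJ(\hat{\mathbf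 x}_s)(\mathbf x_m-\hat{\mathbf x}_s),\ \partial_yJ(\hat{\mathbf x}_s)(\mathbf x_m-\hat{\mathbf x}_s)\,\bigr].$$ Gradient recovery. $G_h:V^h_s\to\mathbf V^h_s$ is the Zhang–Naga gradient recovery operator, needed only on $\overline{\mathcal T}_{s,h}$, the region of triangles of $\Omega_{s,h}$ that contain the nodes of $\Gamma^c_{s,h}$. For a node $z_0=(x_0,y_0)$ of $\overline{\mathcal T}_{s,h}$, let $\mathcal K^0_{z_0}$ be the set of triangles of $\overline{\mathcal T}_{s,h}$ containing $z_0$ and $\mathcal K^i_{z_0}$ the set of triangles of $\overline{\mathcal T}_{s,h}$ containing a node of the triangles of $\mathcal K^{i-1}_{z_0}$; the patch $\mathcal K_{z_0}$ is the $\mathcal K^i_{z_0}$ that has more than $6$ nodes while $\mathcal K^{i-1}_{z_0}$ has at most $6$. Let $p_{z_0}$ be the quadratic polynomial obtained by discrete least-squares fitting (through the normal equations) of the values of $v^h$ at the nodes of $\mathcal K_{z_0}$. Then $G_hv^h$ is the piecewise linear vector function with nodal values $\nabla p_{z_0}(x_0,y_0)$ at each node $z_0$. For $\mathbf v=(v_1,v_2)^T$, $\mathbf G_h\mathbf v$ is the $2\times2$ tensor with rows $(G_hv_1)^T$ and $(G_hv_2)^T$. Extended strain and stress. $\overline\varepsilon(\mathbf v)=\tfrac12\{\mathbf E_{sm}(\mathbf G_h\mathbf v)+[\mathbf E_{sm}(\mathbf G_h\mathbf v)]^T\}$ and $\overline\sigma_s(\mathbf v)=\lambda_s\,\mathrm{tr}(\overline\varepsilon(\mathbf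 v))\,\mathbf I+2\mu_s\,\overline\varepsilon(\mathbf v)$.
   Formalization: Since nonzero linear functions need not vanish on Γ_{i,h}, the trial spaces V^h_i are replaced by piecewise linear functions with Dirichlet data equal to q_i on Γ_{i,h} (test spaces unchanged); the patches and the unique least-squares quadratics defining G_h are assumed to exist. *)

theory Defs
  imports "HOL-Analysis.Analysis"
begin

type_synonym point = "real^2"
type_synonym vfield = "point \<Rightarrow> real^2"
type_synonym tfield = "point \<Rightarrow> real^2^2"

section \<open>Geometry\<close>

text \<open>Locally, after a rigid motion, the set is the strict epigraph of a Lipschitz function.\<close>

definition lipschitz_boundary :: "point set \<Rightarrow> bool" where
  "lipschitz_boundary \<Omega> \<longleftrightarrow>
     (\<forall>x\<in>frontier \<Omega>. \<exists>r>0. \<exists>d e \<gamma> L.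
        norm d = 1 \<and> norm e = 1 \<and> d \<bullet> e = 0 \<and> L-lipschitz_on UNIV (\<gamma> :: real \<Rightarrow> real) \<and>
        \<Omega> \<inter> ball x r = {y \<in> ball x r. \<gamma> (y \<bullet> d) < y \<bullet> e})"

definition lipschitz_domain :: "point set \<Rightarrow> bool" where
  "lipschitz_domain \<Omega> \<longleftrightarrow>
     open \<Omega> \<and> \<Omega> \<noteq> {} \<and> bounded \<Omega> \<and> simply_connected \<Omega> \<and> lipschitz_boundary \<Omega>"

text \<open>A mesh is a finite set of closed triangles; the polygonal domain it covers is \<open>\<Union>\<T>\<close>.
  \<open>nodes\<close> is used for sets of triangles as well as for sets of edges.\<close>

definition nodes :: "point set set \<Rightarrow> point set" where
  "nodes \<T> = {z. \<exists>T\<in>\<T>. z extreme_point_of T}"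

definition mesh_edges :: "point set set \<Rightarrow> point set set" where
  "mesh_edges \<T> = {e. \<exists>T\<in>\<T>. e edge_of T}"

definition mesh_size :: "point set set \<Rightarrow> real" where
  "mesh_size \<T> = Max (diameter ` \<T>)"

text \<open>Since \<open>\<Omega>\<close> may have a curved boundary, \<open>\<Union>\<T>\<close> need not equal the closure of \<open>\<Omega>\<close>; the mesh
  interpolates the boundary of \<open>\<Omega>\<close> at its boundary nodes.\<close>

definition mesh_of :: "point set set \<Rightarrow> point set \<Rightarrow> bool" where
  "mesh_of \<T> \<Omega> \<longleftrightarrow>
     triangulation \<T> \<and> \<T> \<noteq> {} \<and> (\<forall>T\<in>\<T>. 2 simplex T) \<and>
     nodes \<T> \<subseteq> closure \<Omega> \<and> nodes \<T> \<inter> frontier (\<Union>\<T>) \<subseteq> frontier \<Omega>"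

text \<open>A discrete interface is given by its set \<open>E\<close> of edges; as a point set it is \<open>\<Union>E\<close>.  It is a
  polygonal arc in the boundary of the discrete domain, with the same end points as the
  curve \<open>\<Gamma>\<close> and with all its nodes on \<open>\<Gamma>\<close>.\<close>

definition discretizes :: "point set set \<Rightarrow> point set set \<Rightarrow> point set \<Rightarrow> bool" where
  "discretizes E \<T> \<Gamma> \<longleftrightarrow>
     E \<subseteq> mesh_edges \<T> \<and> \<Union>E \<subseteq> frontier (\<Union>\<T>) \<and> nodes E \<subseteq> \<Gamma> \<and>
     (\<exists>g g'. arc g \<and> path_image g = \<Gamma> \<and> arc g' \<and> path_image g' = \<Union>E \<and>
             pathstart g' = pathstart g \<and> pathfinish g' = pathfinish g)"

text \<open>Boundary part carrying the Dirichlet condition.\<close>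

definition dirichlet_part :: "point set set \<Rightarrow> point set set \<Rightarrow> point set" where
  "dirichlet_part \<T> E = frontier (\<Union>\<T>) - \<Union>E"

text \<open>At a boundary point that is not a corner of a polygonal set \<open>S\<close>, the set is locally a
  half plane.  At corners the normal is unspecified; they do not affect integrals.\<close>

definition outward_normal :: "point set \<Rightarrow> point \<Rightarrow> real^2" where
  "outward_normal S x =
     (THE n. norm n = 1 \<and> (\<exists>r>0. \<forall>y\<in>ball x r. y \<in> S \<longleftrightarrow> n \<bullet> (y - x) \<le> 0))"

text \<open>Integration with respect to arc length; the value does not depend on the choice of the
  orientation of the edge.\<close>

definition edge_integral :: "point set \<Rightarrow> (point \<Rightarrow> real) \<Rightarrow> real" where
  "edge_integral e f =
     (let p = (SOME p. e = closed_segment (fst p) (snd p))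
      in dist (fst p) (snd p) * integral {0..1} (\<lambda>t. f (linepath (fst p) (snd p) t)))"

definition pairing_curve :: "point set set \<Rightarrow> vfield \<Rightarrow> vfield \<Rightarrow> real" where
  "pairing_curve E f w = (\<Sum>e\<in>E. edge_integral e (\<lambda>x. f x \<bullet> w x))"

definition pairing_domain :: "point set set \<Rightarrow> vfield \<Rightarrow> vfield \<Rightarrow> real" where
  "pairing_domain \<T> f v = integral (\<Union>\<T>) (\<lambda>x. f x \<bullet> v x)"

section \<open>Finite element spaces\<close>

text \<open>Only the values on \<open>\<Union>\<T>\<close> of a finite element function are relevant.\<close>

definition affine_on :: "point set \<Rightarrow> (point \<Rightarrow> 'a::real_normed_vector) \<Rightarrow> bool" where
  "affine_on T v \<longleftrightarrow> (\<exists>l c. linear l \<and> (\<forall>x\<in>T. v x = l x + c))"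

definition P1 :: "point set set \<Rightarrow> (point \<Rightarrow> 'a::real_normed_vector) set" where
  "P1 \<T> = {v. continuous_on (\<Union>\<T>) v \<and> (\<forall>T\<in>\<T>. affine_on T v)}"

definition V_h :: "point set set \<Rightarrow> point set set \<Rightarrow> vfield set" where
  "V_h \<T> E = {v \<in> P1 \<T>. \<forall>x\<in>dirichlet_part \<T> E. v x = 0}"

definition V_h0 :: "point set set \<Rightarrow> point set set \<Rightarrow> vfield set" where
  "V_h0 \<T> E = {v \<in> V_h \<T> E. \<forall>x\<in>frontier (\<Union>\<T>). v x = 0}"

text \<open>Trial functions with boundary values \<open>g\<close>; for \<open>g = 0\<close> this is \<open>V_h\<close>.\<close>

definition V_trial :: "point set set \<Rightarrow> point set set \<Rightarrow> vfield \<Rightarrow> vfield set" where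
  "V_trial \<T> E g = {v \<in> P1 \<T>. \<forall>x\<in>dirichlet_part \<T> E. v x = g x}"

lemma V_trial_zero: "V_trial \<T> E (\<lambda>_. 0) = V_h \<T> E"
  by (simp add: V_trial_def V_h_def)

text \<open>A function on the interface is in \<open>H\<close>-one-half-zero-zero iff its extension by zero to the whole
  boundary is in \<open>H\<close>-one-half, which for piecewise linear functions means that the
  extension is continuous.\<close>

definition W_h :: "point set set \<Rightarrow> point set set \<Rightarrow> vfield set" where
  "W_h \<T> E = {w. (\<forall>e\<in>E. affine_on e w) \<and>
                 continuous_on (frontier (\<Union>\<T>)) (\<lambda>x. if x \<in> \<Union>E then w x else 0)}"

section \<open>Elasticity\<close>

text \<open>The derivative is taken relative to the closed set \<open>S\<close>, so that at a point in the relative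
  interior of a boundary edge it is the derivative on the adjacent triangle.
  The entry in row \<open>i\<close> and column \<open>j\<close> is the \<open>j\<close>-th partial derivative of the \<open>i\<close>-th component.\<close>

definition grad :: "point set \<Rightarrow> vfield \<Rightarrow> tfield" where
  "grad S v x = matrix (frechet_derivative v (at x within S))"

definition sym_part :: "real^2^2 \<Rightarrow> real^2^2" where
  "sym_part A = (1/2) *\<^sub>R (A + transpose A)"

definition stress :: "real \<Rightarrow> real \<Rightarrow> real^2^2 \<Rightarrow> real^2^2" where
  "stress lam mu eps = (lam * trace eps) *\<^sub>R mat 1 + (2 * mu) *\<^sub>R eps"

definition strain :: "point set \<Rightarrow> vfield \<Rightarrow> tfield" where
  "strain S v x = sym_part (grad S v x)"

text \<open>The inner product of matrices is the Frobenius product.\<close>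

definition bilinear_a :: "point set set \<Rightarrow> real \<Rightarrow> real \<Rightarrow> vfield \<Rightarrow> vfield \<Rightarrow> real" where
  "bilinear_a \<T> lam mu v w =
     integral (\<Union>\<T>) (\<lambda>x. stress lam mu (strain (\<Union>\<T>) v x) \<bullet> strain (\<Union>\<T>) w x)"

section \<open>Taylor expansion operators\<close>

definition taylor_vec :: "point set \<Rightarrow> (point \<Rightarrow> point) \<Rightarrow> vfield \<Rightarrow> vfield" where
  "taylor_vec S \<phi>sm v x = v x + grad S v x *v (\<phi>sm x - x)"

definition tensor_partial :: "point set \<Rightarrow> tfield \<Rightarrow> 2 \<Rightarrow> tfield" where
  "tensor_partial S J j x = frechet_derivative J (at x within S) (axis j 1)"

text \<open>Column \<open>j\<close> of the correction is the \<open>j\<close>-th partial derivative of \<open>J\<close> applied to the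
  displacement.\<close>

definition taylor_tensor :: "point set \<Rightarrow> (point \<Rightarrow> point) \<Rightarrow> tfield \<Rightarrow> tfield" where
  "taylor_tensor S \<phi>ms J x =
     J (\<phi>ms x) + (\<chi> i j. (tensor_partial S J j (\<phi>ms x) *v (x - \<phi>ms x)) $ i)"

section \<open>Gradient recovery\<close>

text \<open>The triangles having a node of the interface as a vertex.\<close>

definition strip :: "point set set \<Rightarrow> point set set \<Rightarrow> point set set" where
  "strip \<T> E = {T\<in>\<T>. \<exists>z\<in>nodes E. z \<in> T}"

primrec layer :: "point set set \<Rightarrow> point \<Rightarrow> nat \<Rightarrow> point set set" where
  "layer \<S> z 0 = {T\<in>\<S>. z \<in> T}"
| "layer \<S> z (Suc i) = {T\<in>\<S>. \<exists>y\<in>nodes (layer \<S> z i). y \<in> T}"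

definition patch :: "point set set \<Rightarrow> point \<Rightarrow> point set set" where
  "patch \<S> z = layer \<S> z (LEAST i. card (nodes (layer \<S> z i)) > 6)"

definition quadratics :: "(point \<Rightarrow> real) set" where
  "quadratics = {p. \<exists>a b c d e f. \<forall>x.
     p x = a + b * x$1 + c * x$2 + d * (x$1)^2 + e * (x$1 * x$2) + f * (x$2)^2}"

text \<open>The minimizers are exactly the solutions of the normal equations.\<close>

definition least_squares_fit :: "point set \<Rightarrow> (point \<Rightarrow> real) \<Rightarrow> (point \<Rightarrow> real) \<Rightarrow> bool" where
  "least_squares_fit Z v p \<longleftrightarrow>
     is_arg_min (\<lambda>p. \<Sum>z\<in>Z. (p z - v z)^2) (\<lambda>p. p \<in> quadratics) p"

text \<open>Recovery is well posed if every patch exists and every fitting problem has a unique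
  solution, that is, the normal equations are nonsingular.  Otherwise ``the'' fitted
  polynomial, and hence the recovery operator, is undefined.\<close>

definition recovery_well_posed :: "point set set \<Rightarrow> bool" where
  "recovery_well_posed \<S> \<longleftrightarrow>
     (\<forall>z\<in>nodes \<S>. (\<exists>i. card (nodes (layer \<S> z i)) > 6) \<and>
                  (\<forall>v. \<exists>!p. least_squares_fit (nodes (patch \<S> z)) v p))"

definition fitted_poly :: "point set set \<Rightarrow> (point \<Rightarrow> real) \<Rightarrow> point \<Rightarrow> (point \<Rightarrow> real)" where
  "fitted_poly \<S> v z = (THE p. least_squares_fit (nodes (patch \<S> z)) v p)"

definition gradient_at :: "(point \<Rightarrow> real) \<Rightarrow> point \<Rightarrow> real^2" where
  "gradient_at p x = (\<chi> j. frechet_derivative p (at x) (axis j 1))"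

text \<open>On \<open>\<Union>\<S>\<close> there is exactly one piecewise linear function with prescribed nodal values.\<close>

definition nodal_interpolant :: "point set set \<Rightarrow> (point \<Rightarrow> 'a::real_normed_vector) \<Rightarrow> (point \<Rightarrow> 'a)" where
  "nodal_interpolant \<S> g = (SOME w. w \<in> P1 \<S> \<and> (\<forall>z\<in>nodes \<S>. w z = g z))"

definition recovered_grad :: "point set set \<Rightarrow> (point \<Rightarrow> real) \<Rightarrow> vfield" where
  "recovered_grad \<S> v = nodal_interpolant \<S> (\<lambda>z. gradient_at (fitted_poly \<S> v z) z)"

text \<open>Row \<open>i\<close> of the tensor is the recovered gradient of the \<open>i\<close>-th component.\<close>

definition recovered_tensor :: "point set set \<Rightarrow> vfield \<Rightarrow> tfield" where
  "recovered_tensor \<S> v x = (\<chi> i. recovered_grad \<S> (\<lambda>y. v y $ i) x)"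

definition extended_strain :: "point set set \<Rightarrow> (point \<Rightarrow> point) \<Rightarrow> vfield \<Rightarrow> tfield" where
  "extended_strain \<S> \<phi>ms v x = sym_part (taylor_tensor (\<Union>\<S>) \<phi>ms (recovered_tensor \<S> v) x)"

definition extended_stress ::
  "point set set \<Rightarrow> (point \<Rightarrow> point) \<Rightarrow> real \<Rightarrow> real \<Rightarrow> vfield \<Rightarrow> tfield" where
  "extended_stress \<S> \<phi>ms lam mu v x = stress lam mu (extended_strain \<S> \<phi>ms v x)"

section \<open>The discrete coupled problem\<close>

text \<open>With \<open>gs = gm = 0\<close> the trial spaces are \<open>V_h \<T>s Es\<close> and \<open>V_h \<T>m Em\<close>.  Since a nonzero linear
  function does not in general vanish on the Dirichlet part of the boundary, prescribed
  boundary values are allowed.  The test spaces always have zero boundary values.\<close>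

definition solves_coupled_problem ::
  "point set set \<Rightarrow> point set set \<Rightarrow> point set set \<Rightarrow> point set set \<Rightarrow>
   (point \<Rightarrow> point) \<Rightarrow> (point \<Rightarrow> point) \<Rightarrow> real \<Rightarrow> real \<Rightarrow> real \<Rightarrow> real \<Rightarrow>
   vfield \<Rightarrow> vfield \<Rightarrow> vfield \<Rightarrow> vfield \<Rightarrow> vfield \<Rightarrow> vfield \<Rightarrow> bool" where
  "solves_coupled_problem \<T>s Es \<T>m Em \<phi>sm \<phi>ms lams mus lamm mum fs fm gs gm us um \<longleftrightarrow>
     us \<in> V_trial \<T>s Es gs \<and> um \<in> V_trial \<T>m Em gm \<and>
     (\<forall>v\<in>V_h0 \<T>s Es. bilinear_a \<T>s lams mus us v = pairing_domain \<T>s fs v) \<and>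
     (\<forall>w\<in>W_h \<T>s Es.
        pairing_curve Es (\<lambda>x. taylor_vec (\<Union>\<T>s) \<phi>sm us x - um (\<phi>sm x)) w = 0) \<and>
     (\<forall>v\<in>V_h \<T>m Em.
        bilinear_a \<T>m lamm mum um v -
        pairing_curve Em (\<lambda>x. extended_stress (strip \<T>s Es) \<phi>ms lams mus us x *v
                                outward_normal (\<Union>\<T>m) x) v =
        pairing_domain \<T>m fm v)"

end

theory Submission
  imports Defs
begin

text \<open>For linear data every discretization step is exact.  The Taylor expansion reproduces a
  linear function.  Its own component is the unique least-squares quadratic fit on each patch, so the
  recovered gradient is the constant matrix \<open>A\<close> and the extended stress is the constant stress
  of \<open>A\<close>.  Both variational equations then reduce to one identity: for a constant stress and a
  piecewise linear test function, apply the divergence theorem on each triangle and add up.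
  Inner edges cancel, edges outside the interface drop out because the test function vanishes
  there, and only the interface term remains.\<close>

section \<open>Outward normals\<close>

text \<open>Normals, fitted polynomials, interpolants, derivatives relative to a closed set and the
  orientation of an edge are all chosen by \<open>THE\<close> or \<open>SOME\<close>, so much of the
  work is to pin these choices down or to show that they do not matter. For normals this is done by
  a local half-plane condition: at most one vector satisfies it, it passes from a triangle to the
  mesh where no other triangle is near, and it forces opposite vectors for two triangles with
  disjoint interiors. Neighbours can thus be compared without naming their vertices. What stays
  undetermined, the normal at corners and the gradient of a test function on triangle sides,
  concerns null sets only; hence edge integrals are compared on open segments and area integrals on
  interiors. On a single triangle the length of each edge cancels the normalisation of its normal,
  and the divergence theorem becomes a polynomial identity in the coordinates of the
  vertices.\<close>

definition cross2 :: "real^2 \<Rightarrow> real^2 \<Rightarrow> real" where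
  "cross2 u w = u$1 * w$2 - u$2 * w$1"

text \<open>The counterclockwise quarter turn. It sends an edge vector to a normal of the edge, and
  its inner product is the determinant \<open>cross2\<close>, so normals and signed areas share one
  formula.\<close>

definition rot :: "real^2 \<Rightarrow> real^2" where
  "rot u = vector [- u$2, u$1]"

lemma inner_rot: "rot u \<bullet> w = cross2 u w"
  by (simp add: rot_def cross2_def inner_vec_def sum_2)

lemma norm_rot: "norm (rot u) = norm u"
  by (simp add: rot_def norm_vec_def L2_set_def sum_2 add.commute)

text \<open>The condition under the \<open>THE\<close> of \<open>outward_normal\<close>, isolated so
  that existence, uniqueness and locality can be treated separately.\<close>

definition half_plane_at :: "point set \<Rightarrow> point \<Rightarrow> real^2 \<Rightarrow> bool" where
  "half_plane_at S x n \<longleftrightarrow>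
     norm n = 1 \<and> (\<exists>r>0. \<forall>y\<in>ball x r. y \<in> S \<longleftrightarrow> n \<bullet> (y - x) \<le> 0)"

lemma small_step_in_ball:
  fixes x w :: "'a::real_normed_vector"
  assumes "r > 0"
  obtains t where "t > 0" "x + t *\<^sub>R w \<in> ball x r"
proof
  show "r / (2 * (norm w + 1)) > 0" using assms by (simp add: add_nonneg_pos)
  have "norm w / (2 * (norm w + 1)) < 1"
    by (simp add: divide_less_eq add_nonneg_pos)
  from mult_strict_left_mono[OF this assms]
  have "r * (norm w / (2 * (norm w + 1))) < r" by simp
  then show "x + (r / (2 * (norm w + 1))) *\<^sub>R w \<in> ball x r"
    using assms by (simp add: dist_norm)
qed

lemma unit_inner_less_one:
  assumes "norm n = 1" "norm n' = 1" "n \<noteq> (n' :: 'a::real_inner)"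
  shows "n \<bullet> n' < 1"
proof -
  have "norm (n - n') > 0" using assms by simp
  then have "(n - n') \<bullet> (n - n') > 0" by simp
  moreover have "(n - n') \<bullet> (n - n') = 2 - 2 * (n \<bullet> n')"
    using assms by (simp add: inner_diff inner_commute norm_eq_1)
  ultimately show ?thesis by simp
qed

text \<open>For two different unit vectors, a small step from \<open>x\<close> along
  \<open>n' - n\<close> enters the half plane of \<open>n\<close> and leaves that of
  \<open>n'\<close>, so the end point would both belong and not belong to \<open>S\<close>.\<close>

lemma half_plane_at_unique:
  assumes "half_plane_at S x n" "half_plane_at S x n'"
  shows "n = n'"
proof (rule ccontr)
  assume ne: "n \<noteq> n'"
  obtain r where r: "r > 0" "\<forall>y\<in>ball x r. y \<in> S \<longleftrightarrow> n \<bullet> (y - x) \<le> 0" "norm n = 1"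
    using assms(1) half_plane_at_def by auto
  obtain r' where r': "r' > 0" "\<forall>y\<in>ball x r'. y \<in> S \<longleftrightarrow> n' \<bullet> (y - x) \<le> 0" "norm n' = 1"
    using assms(2) half_plane_at_def by auto
  have less: "n \<bullet> n' < 1" using unit_inner_less_one r(3) r'(3) ne by blast
  obtain t where t: "t > 0" "x + t *\<^sub>R (n' - n) \<in> ball x (min r r')"
    by (rule small_step_in_ball[of "min r r'" x]) (use r r' in auto)
  have "n \<bullet> (t *\<^sub>R (n' - n)) < 0"
    using t less r(3) by (simp add: inner_diff norm_eq_1 mult_less_0_iff)
  moreover have "n' \<bullet> (t *\<^sub>R (n' - n)) > 0"
    using t less r'(3) by (simp add: inner_diff norm_eq_1 inner_commute)
  ultimately show False using r(2) r'(2) t(2)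
    by (force simp del: inner_scaleR_right dest!: bspec[where x = "x + t *\<^sub>R (n' - n)"])
qed

lemma outward_normal_eqI:
  assumes "half_plane_at S x n"
  shows "outward_normal S x = n"
  unfolding outward_normal_def
  using assms half_plane_at_unique unfolding half_plane_at_def
  by (intro the_equality) blast+

text \<open>Unless the vectors are opposite, the two open half planes overlap near \<open>x\<close>:
  a small step along \<open>- (n + n')\<close> lies in both, and the overlap is an open subset of
  \<open>S \<inter> S'\<close>.\<close>

lemma half_plane_at_opposite:
  assumes "half_plane_at S x n" "half_plane_at S' x n'" "interior (S \<inter> S') = {}"
  shows "n' = - n"
proof (rule ccontr)
  assume ne: "n' \<noteq> - n"
  obtain r where r: "r > 0" "\<forall>y\<in>ball x r. y \<in> S \<longleftrightarrow> n \<bullet> (y - x) \<le> 0" "norm n = 1"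
    using assms(1) half_plane_at_def by auto
  obtain r' where r': "r' > 0" "\<forall>y\<in>ball x r'. y \<in> S' \<longleftrightarrow> n' \<bullet> (y - x) \<le> 0" "norm n' = 1"
    using assms(2) half_plane_at_def by auto
  have "n' \<bullet> (- n) < 1" using unit_inner_less_one[of n' "- n"] r(3) r'(3) ne by simp
  then have less: "n \<bullet> n' > - 1" by (simp add: inner_commute)
  define U where "U = ball x (min r r') \<inter> {y. n \<bullet> (y - x) < 0} \<inter> {y. n' \<bullet> (y - x) < 0}"
  have "open U" unfolding U_def
    by (intro open_Int open_ball open_Collect_less continuous_intros)
  moreover have "U \<subseteq> S \<inter> S'" using r(2) r'(2) by (auto simp: U_def)
  ultimately have "U = {}" using assms(3) interior_maximal by blast
  obtain t where t: "t > 0" "x + t *\<^sub>R (- (n + n')) \<in> ball x (min r r')"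
    by (rule small_step_in_ball[of "min r r'" x]) (use r r' in auto)
  have "n \<bullet> (t *\<^sub>R (- (n + n'))) < 0" "n' \<bullet> (t *\<^sub>R (- (n + n'))) < 0"
    using t less r(3) r'(3)
    by (simp_all add: inner_add norm_eq_1 inner_commute inner_minus_right mult_less_0_iff
        del: minus_add_distrib add_uminus_conv_diff)
  then have "x + t *\<^sub>R (- (n + n')) \<in> U" using t(2) by (simp add: U_def)
  with \<open>U = {}\<close> show False by blast
qed

text \<open>The point itself lies in \<open>S\<close>, while arbitrarily small steps along
  \<open>n\<close> leave it.\<close>

lemma half_plane_at_in_frontier:
  assumes "half_plane_at S x n"
  shows "x \<in> frontier S"
proof -
  obtain r where r: "r > 0" "\<forall>y\<in>ball x r. y \<in> S \<longleftrightarrow> n \<bullet> (y - x) \<le> 0" "norm n = 1"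
    using assms half_plane_at_def by auto
  have "\<exists>y\<in>S. dist x y < e" if "e > 0" for e
    using r that by (intro bexI[of _ x]) auto
  moreover have "\<exists>y. y \<notin> S \<and> dist x y < e" if e: "e > 0" for e
  proof -
    obtain t where t: "t > 0" "x + t *\<^sub>R n \<in> ball x (min r e)"
      by (rule small_step_in_ball[of "min r e" x n]) (use r e in auto)
    have "n \<bullet> (t *\<^sub>R n) > 0" using t r(3) by (simp add: norm_eq_1)
    then show ?thesis using t r(2) by (intro exI[of _ "x + t *\<^sub>R n"]) (auto simp: not_le)
  qed
  ultimately show ?thesis by (auto simp: frontier_straddle)
qed

lemma half_plane_at_cong:
  assumes "half_plane_at S x n" "open U" "x \<in> U" "S' \<inter> U = S \<inter> U"
  shows "half_plane_at S' x n"
proof -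
  obtain r where r: "r > 0" "\<forall>y\<in>ball x r. y \<in> S \<longleftrightarrow> n \<bullet> (y - x) \<le> 0" "norm n = 1"
    using assms half_plane_at_def by auto
  obtain e where e: "e > 0" "ball x e \<subseteq> U" using assms open_contains_ball by blast
  have "\<forall>y\<in>ball x (min r e). y \<in> S' \<longleftrightarrow> n \<bullet> (y - x) \<le> 0"
  proof
    fix y assume y: "y \<in> ball x (min r e)"
    then have "y \<in> S' \<longleftrightarrow> y \<in> S" using e(2) assms(4) by auto
    then show "y \<in> S' \<longleftrightarrow> n \<bullet> (y - x) \<le> 0" using y r(2) by simp
  qed
  then show ?thesis unfolding half_plane_at_def using r e by (auto intro!: exI[of _ "min r e"])
qed

text \<open>Two opposite closed half planes fill a ball around \<open>x\<close>. This shows that an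
  edge with triangles on both sides is not a boundary edge.\<close>

lemma union_opposite_half_planes_interior:
  assumes "half_plane_at S x n" "half_plane_at S' x (- n)" "S \<union> S' \<subseteq> U"
  shows "x \<in> interior U"
proof -
  obtain r where r: "r > 0" "\<forall>y\<in>ball x r. y \<in> S \<longleftrightarrow> n \<bullet> (y - x) \<le> 0"
    using assms(1) half_plane_at_def by auto
  obtain r' where r': "r' > 0" "\<forall>y\<in>ball x r'. y \<in> S' \<longleftrightarrow> - n \<bullet> (y - x) \<le> 0"
    using assms(2) half_plane_at_def by auto
  have "ball x (min r r') \<subseteq> S \<union> S'"
  proof
    fix y assume y: "y \<in> ball x (min r r')"
    then show "y \<in> S \<union> S'" using r(2) r'(2) by (cases "n \<bullet> (y - x) \<le> 0") auto
  qed
  then show ?thesis using assms(3) r r'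
    by (metis centre_in_ball interior_maximal min_less_iff_conj open_ball subset_iff subset_trans)
qed

section \<open>Triangles\<close>

lemma simplex_interior_nonempty:
  assumes "2 simplex (T :: point set)"
  shows "interior T \<noteq> {}"
proof -
  have "aff_dim T = 2" using assms by (rule aff_dim_simplex)
  then have "aff_dim T = int DIM(point)" by simp
  then have "rel_interior T = interior T"
    by (metis aff_dim_eq_full rel_interior_interior)
  moreover have "T \<noteq> {}" using assms by auto
  ultimately show ?thesis
    using assms convex_simplex rel_interior_eq_empty by metis
qed

lemma triangle_vertices:
  assumes "2 simplex (T :: point set)"
  obtains a b c where "T = convex hull {a,b,c}" "\<not> affine_dependent {a,b,c}"
    "a \<noteq> b" "b \<noteq> c" "a \<noteq> c" "cross2 (b - a) (c - a) \<noteq> 0"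
proof -
  obtain C where C: "\<not> affine_dependent C" "int (card C) = 3" "T = convex hull C"
    using assms unfolding simplex_def by auto
  then obtain a b c where abc: "C = {a,b,c}" "a \<noteq> b" "b \<noteq> c" "a \<noteq> c"
    using card_3_iff[of C] by auto
  \<comment> \<open>Nondegeneracy is read off from the area: a triangle with interior points has
    positive measure, and the area formula is half of the absolute value of the determinant.\<close>
  have "\<not> negligible T"
    using simplex_interior_nonempty[OF assms] negligible_convex_interior convex_simplex[OF assms]
    by blast
  moreover have "compact T" using assms by (rule compact_simplex)
  ultimately have "measure lebesgue T \<noteq> 0"
    using negligible_iff_measure lmeasurable_compact by blast
  moreover have "measure lebesgue T = measure lborel T"
    using \<open>compact T\<close> by (simp add: compact_imp_closed)
  ultimately have "measure lborel T \<noteq> 0" by simp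
  then have "cross2 (b - a) (c - a) \<noteq> 0"
    unfolding C abc content_triangle cross2_def by (auto simp: algebra_simps)
  then show thesis using that C abc by blast
qed

text \<open>The three quotients are the barycentric coordinates of \<open>y\<close>, written as
  ratios of signed areas. They are the only coefficients with sum 1 that represent
  \<open>y\<close>.\<close>

lemma mem_triangle_iff:
  assumes "cross2 (b - a) (c - a) \<noteq> 0" (is "?d \<noteq> 0")
  shows "y \<in> convex hull {a,b,c} \<longleftrightarrow>
    cross2 (c - b) (y - b) / ?d \<ge> 0 \<and> cross2 (a - c) (y - c) / ?d \<ge> 0 \<and> cross2 (b - a) (y - a) / ?d \<ge> 0"
    (is "_ \<longleftrightarrow> ?u y \<ge> 0 \<and> ?v y \<ge> 0 \<and> ?w y \<ge> 0")
proof -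
  have sum: "?u y + ?v y + ?w y = 1"
    using assms by (simp add: field_simps) (simp add: cross2_def algebra_simps)
  have comb: "y = ?u y *\<^sub>R a + ?v y *\<^sub>R b + ?w y *\<^sub>R c"
    using assms by (simp add: vec_eq_iff forall_2 field_simps) (simp add: cross2_def algebra_simps)
  have unique: "u = ?u y \<and> v = ?v y \<and> w = ?w y"
    if "y = u *\<^sub>R a + v *\<^sub>R b + w *\<^sub>R c" "u + v + w = 1" for u v w
  proof -
    have [simp]: "u = 1 - v - w" using that by simp
    show ?thesis using assms
      by (simp add: that(1) field_simps) (simp add: cross2_def algebra_simps)
  qed
  show ?thesis
  proof
    assume "y \<in> convex hull {a,b,c}"
    then obtain u v w where "0 \<le> u" "0 \<le> v" "0 \<le> w" "u + v + w = 1"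
        "y = u *\<^sub>R a + v *\<^sub>R b + w *\<^sub>R c"
      unfolding convex_hull_3 by blast
    then show "?u y \<ge> 0 \<and> ?v y \<ge> 0 \<and> ?w y \<ge> 0" using unique by metis
  next
    assume "?u y \<ge> 0 \<and> ?v y \<ge> 0 \<and> ?w y \<ge> 0"
    then show "y \<in> convex hull {a,b,c}" unfolding convex_hull_3 using sum comb by blast
  qed
qed

text \<open>At an inner point of the edge the barycentric coordinates of \<open>a\<close> and
  \<open>b\<close> are positive, and they stay so nearby; membership is then decided by the sign of
  the coordinate of \<open>c\<close>, which vanishes on the line through \<open>a\<close> and
  \<open>b\<close>. As \<open>rot (b - a)\<close> points to the left of the edge, the factor
  \<open>- sgn d\<close> makes it point away from \<open>c\<close>.\<close>

lemma half_plane_at_triangle_edge: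
  fixes a b c :: point
  defines "d \<equiv> cross2 (b - a) (c - a)"
  assumes "d \<noteq> 0" "x \<in> open_segment a b"
  shows "half_plane_at (convex hull {a,b,c}) x ((- sgn d / dist a b) *\<^sub>R rot (b - a))"
    (is "half_plane_at ?T x ?n")
proof -
  have "a \<noteq> b" using assms(3) by auto
  obtain t where t: "0 < t" "t < 1" "x = (1 - t) *\<^sub>R a + t *\<^sub>R b"
    using assms(3) by (auto simp: in_segment)
  have "norm ?n = 1"
    using \<open>a \<noteq> b\<close> \<open>d \<noteq> 0\<close> by (simp add: norm_rot dist_norm norm_minus_commute abs_sgn_eq)
  define U where "U = {y. 0 < cross2 (c - b) (y - b) / d} \<inter> {y. 0 < cross2 (a - c) (y - c) / d}"
  have "open U" unfolding U_def cross2_def divide_inverse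
    by (intro open_Int open_Collect_less continuous_intros)
  have "cross2 (c - b) (x - b) = (1 - t) * d" "cross2 (a - c) (x - c) = t * d"
    by (simp_all add: t d_def cross2_def algebra_simps)
  then have "x \<in> U" using t \<open>d \<noteq> 0\<close> by (simp add: U_def)
  with \<open>open U\<close> obtain r where r: "r > 0" "ball x r \<subseteq> U" using open_contains_ball by blast
  have "y \<in> ?T \<longleftrightarrow> ?n \<bullet> (y - x) \<le> 0" if "y \<in> ball x r" for y
  proof -
    have "y \<in> U" using that r by blast
    then have "y \<in> ?T \<longleftrightarrow> cross2 (b - a) (y - a) / d \<ge> 0"
      using mem_triangle_iff[of b a c y] \<open>d \<noteq> 0\<close> by (auto simp: U_def d_def)
    also have "cross2 (b - a) (y - a) = cross2 (b - a) (y - x)"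
      by (simp add: t cross2_def algebra_simps)
    also have "\<dots> / d \<ge> 0 \<longleftrightarrow> ?n \<bullet> (y - x) \<le> 0"
      using \<open>a \<noteq> b\<close> \<open>d \<noteq> 0\<close>
      by (simp add: inner_rot zero_le_divide_iff divide_le_0_iff mult_le_0_iff sgn_if zero_le_mult_iff)
    finally show ?thesis .
  qed
  then show ?thesis unfolding half_plane_at_def using r \<open>norm ?n = 1\<close> by blast
qed

text \<open>Faces of a simplex are the hulls of subsets of its vertices, and dimension one selects
  the pairs.\<close>

lemma edges_of_triangle:
  assumes "\<not> affine_dependent {a,b,c}" "a \<noteq> b" "b \<noteq> c" "a \<noteq> c"
  shows "{e. e edge_of (convex hull {a,b,c})} =
    {closed_segment a b, closed_segment b c, closed_segment c (a :: point)}"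
proof -
  have *: "aff_dim (convex hull C) = 1 \<longleftrightarrow> card C = 2" if "C \<subseteq> {a,b,c}" for C
    using affine_independent_subset[OF assms(1) that]
    by (simp add: aff_dim_convex_hull affine_independent_iff_card)
  have "C \<in> {{a,b},{b,c},{c,a}} \<longleftrightarrow> C \<subseteq> {a,b,c} \<and> card C = 2" for C
  proof
    assume "C \<subseteq> {a,b,c} \<and> card C = 2"
    then obtain p q where "C = {p,q}" "p \<noteq> q" "{p,q} \<subseteq> {a,b,c}"
      by (metis card_2_iff)
    then show "C \<in> {{a,b},{b,c},{c,a}}" by auto
  qed (use assms in auto)
  then have "{C. C \<subseteq> {a,b,c} \<and> card C = 2} = {{a,b},{b,c},{c,a}}" by blast
  moreover have "{e. e edge_of (convex hull {a,b,c})} = (\<lambda>C. convex hull C) ` {C. C \<subseteq> {a,b,c} \<and> card C = 2}"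
    using * unfolding edge_of_def face_of_convex_hull_affine_independent[OF assms(1)] by blast
  ultimately show ?thesis by (simp add: segment_convex_hull)
qed

section \<open>The divergence theorem on a triangle\<close>

text \<open>The order of the end points chosen by \<open>SOME\<close> is unknown, but the choice
  depends on the edge alone. One pair \<open>p\<close>, \<open>q\<close> therefore serves all
  integrands.\<close>

lemma edge_integral_segment:
  obtains p q where "{p,q} = {a,b}"
    "\<And>f. edge_integral (closed_segment a b) f = dist p q * integral {0..1} (\<lambda>t. f (linepath p q t))"
proof -
  define r where "r = (SOME r. closed_segment a b = closed_segment (fst r) (snd r))"
  have "closed_segment a b = closed_segment (fst r) (snd r)"
    unfolding r_def by (rule someI[of _ "(a, b)"]) simp
  then have "{fst r, snd r} = {a,b}" by (metis closed_segment_eq)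
  then show thesis
    by (rule that) (simp add: edge_integral_def r_def Let_def)
qed

lemma linepath_in_open_segment:
  assumes "a \<noteq> b" "{p,q} = {a,b}" "t \<in> {0..1} - {0,1}"
  shows "linepath p q t \<in> open_segment a b"
proof -
  have "linepath p q t \<in> open_segment p q"
    using assms by (auto simp: in_segment linepath_def doubleton_eq_iff intro!: exI[of _ t])
  then show ?thesis using assms(2) by (auto simp: doubleton_eq_iff open_segment_commute)
qed

text \<open>The end points are a null set of parameters. Unspecified normals at corners are harmless
  for this reason.\<close>

lemma edge_integral_cong:
  assumes "a \<noteq> b" "\<And>x. x \<in> open_segment a b \<Longrightarrow> f x = g x"
  shows "edge_integral (closed_segment a b) f = edge_integral (closed_segment a b) g"
proof (rule edge_integral_segment[of a b])
  fix p q assume pq: "{p,q} = {a,b}" and eq: "\<And>f. edge_integral (closed_segment a b) f =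
      dist p q * integral {0..1} (\<lambda>t. f (linepath p q t))"
  have "integral {0..1} (\<lambda>t. f (linepath p q t)) = integral {0..1} (\<lambda>t. g (linepath p q t))"
    using assms(2) linepath_in_open_segment[OF assms(1) pq]
    by (intro integral_spike[of "{0,1}"]) auto
  then show ?thesis by (simp add: eq)
qed

lemma edge_integral_zero [simp]: "edge_integral e (\<lambda>x. 0) = 0"
  by (simp add: edge_integral_def Let_def)

lemma edge_integral_minus: "edge_integral e (\<lambda>x. - f x) = - edge_integral e f"
  by (simp add: edge_integral_def Let_def)

text \<open>The midpoint rule is exact for affine integrands, and its value is symmetric in the end
  points, so the unknown orientation disappears.\<close>

lemma edge_integral_affine:
  assumes "a \<noteq> b" "linear l" "\<And>x. x \<in> open_segment a b \<Longrightarrow> f x = l x + k"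
  shows "edge_integral (closed_segment a b) f = dist a b * (l (midpoint a b) + k)"
proof (rule edge_integral_segment[of a b])
  fix p q assume pq: "{p,q} = {a,b}" and eq: "\<And>f. edge_integral (closed_segment a b) f =
      dist p q * integral {0..1} (\<lambda>t. f (linepath p q t))"
  have "((\<lambda>t. l p + k + t * (l q - l p)) has_integral
      ((l p + k) * 1 + 1\<^sup>2 / 2 * (l q - l p)) - ((l p + k) * 0 + 0\<^sup>2 / 2 * (l q - l p))) {0..1}"
    by (intro fundamental_theorem_of_calculus)
       (auto intro!: derivative_eq_intros simp: has_real_derivative_iff_has_vector_derivative[symmetric])
  moreover have "(\<lambda>t. l (linepath p q t) + k) = (\<lambda>t. l p + k + t * (l q - l p))"
    using assms(2) by (simp add: linepath_def linear_add linear_diff linear_cmul algebra_simps)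
  ultimately have "integral {0..1} (\<lambda>t. l (linepath p q t) + k) = (l p + l q) / 2 + k"
    by (simp add: integral_unique field_simps)
  also have "\<dots> = l (midpoint p q) + k"
    using assms(2) by (simp add: midpoint_def linear_add linear_cmul)
  finally have "edge_integral (closed_segment a b) (\<lambda>x. l x + k) = dist p q * (l (midpoint p q) + k)"
    by (simp add: eq)
  moreover have "dist p q = dist a b" "midpoint p q = midpoint a b"
    using pq by (auto simp: doubleton_eq_iff dist_commute midpoint_sym)
  ultimately show ?thesis using edge_integral_cong[OF assms(1,3)] by simp
qed

text \<open>The edge length from the midpoint rule cancels the factor \<open>1 / dist a b\<close> of
  the unit normal, which leaves an expression without square roots.\<close>

lemma triangle_edge_flux:
  fixes a b c :: point and v :: vfield
  defines "d \<equiv> cross2 (b - a) (c - a)"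
  assumes "d \<noteq> 0" "linear l" and v: "\<And>x. x \<in> convex hull {a,b,c} \<Longrightarrow> v x = l x + k"
  shows "edge_integral (closed_segment a b) (\<lambda>x. (S *v outward_normal (convex hull {a,b,c}) x) \<bullet> v x) =
    - sgn d * ((S *v rot (b - a)) \<bullet> (l (midpoint a b) + k))"
proof -
  define n where "n = (- sgn d / dist a b) *\<^sub>R rot (b - a)"
  have "a \<noteq> b" using \<open>d \<noteq> 0\<close> by (auto simp: d_def cross2_def)
  have sub: "open_segment a b \<subseteq> convex hull {a,b,c}"
    using hull_mono[of "{a,b}" "{a,b,c}" convex] segment_open_subset_closed[of a b]
    by (simp add: segment_convex_hull)
  have "linear (\<lambda>x. (S *v n) \<bullet> l x)"
    by (intro linearI) (simp_all add: linear_add linear_cmul assms inner_add_right)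
  moreover have "(S *v outward_normal (convex hull {a,b,c}) x) \<bullet> v x = (S *v n) \<bullet> l x + (S *v n) \<bullet> k"
    if "x \<in> open_segment a b" for x
  proof -
    have "outward_normal (convex hull {a,b,c}) x = n"
      unfolding n_def d_def
      using half_plane_at_triangle_edge[of b a c x] that \<open>d \<noteq> 0\<close>
      by (intro outward_normal_eqI) (simp add: d_def)
    moreover have "x \<in> convex hull {a,b,c}" using that sub by blast
    ultimately show ?thesis by (simp add: v inner_add_right)
  qed
  ultimately have "edge_integral (closed_segment a b) (\<lambda>x. (S *v outward_normal (convex hull {a,b,c}) x) \<bullet> v x)
    = dist a b * ((S *v n) \<bullet> l (midpoint a b) + (S *v n) \<bullet> k)"
    by (rule edge_integral_affine[OF \<open>a \<noteq> b\<close>])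
  also have "S *v n = (- sgn d / dist a b) *\<^sub>R (S *v rot (b - a))"
    unfolding n_def by (rule matrix_vector_mult_scaleR)
  also have "dist a b * (\<dots> \<bullet> l (midpoint a b) + \<dots> \<bullet> k)
      = - sgn d * ((S *v rot (b - a)) \<bullet> (l (midpoint a b) + k))"
    using \<open>a \<noteq> b\<close> by (simp add: inner_add_right field_simps)
  finally show ?thesis .
qed

lemma triangle_green:
  fixes v :: vfield
  assumes "2 simplex T" "linear l" and v: "\<And>x. x \<in> T \<Longrightarrow> v x = l x + k"
  shows "measure lborel T * (S \<bullet> matrix l) =
    (\<Sum>e | e edge_of T. edge_integral e (\<lambda>x. (S *v outward_normal T x) \<bullet> v x))"
proof -
  obtain a b c where T: "T = convex hull {a,b,c}" and ind: "\<not> affine_dependent {a,b,c}"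
    and ne: "a \<noteq> b" "b \<noteq> c" "a \<noteq> c" and nz: "cross2 (b - a) (c - a) \<noteq> 0"
    using triangle_vertices[OF assms(1)] by metis
  define d where "d = cross2 (b - a) (c - a)"
  \<comment> \<open>Cyclic relabelling preserves the orientation, so the three edges carry the same
    factor \<open>sgn d\<close>.\<close>
  have d: "cross2 (c - b) (a - b) = d" "cross2 (a - c) (b - c) = d"
    by (simp_all add: d_def cross2_def algebra_simps)
  have T': "T = convex hull {b,c,a}" "T = convex hull {c,a,b}"
    by (simp_all add: T insert_commute)
  define M where "M = matrix l"
  have l: "l x = M *v x" for x
    using assms(2) by (simp add: M_def matrix_works linear_matrix_vector_mul_eq)
  let ?f = "\<lambda>x. (S *v outward_normal T x) \<bullet> v x"
  have 1: "edge_integral (closed_segment a b) ?f = - sgn d * ((S *v rot (b - a)) \<bullet> (l (midpoint a b) + k))"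
    using triangle_edge_flux[of b a c l v k S] nz v assms(2) unfolding T d_def by blast
  have 2: "edge_integral (closed_segment b c) ?f = - sgn d * ((S *v rot (c - b)) \<bullet> (l (midpoint b c) + k))"
    using triangle_edge_flux[of c b a l v k S] nz v assms(2) unfolding d d_def[symmetric] T'(1) by blast
  have 3: "edge_integral (closed_segment c a) ?f = - sgn d * ((S *v rot (a - c)) \<bullet> (l (midpoint c a) + k))"
    using triangle_edge_flux[of a c b l v k S] nz v assms(2) unfolding d d_def[symmetric] T'(2) by blast
  have "measure lborel T = sgn d * d / 2"
    unfolding T content_triangle d_def cross2_def by (simp add: sgn_if abs_if algebra_simps)
  then have "measure lborel T * (S \<bullet> M) = sgn d * (d / 2 * (S \<bullet> M))" by simp
  \<comment> \<open>A polynomial identity, checked by expansion in coordinates. The constant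
    \<open>k\<close> cancels because the edge vectors add up to zero.\<close>
  also have "d / 2 * (S \<bullet> M) = - ((S *v rot (b - a)) \<bullet> (l (midpoint a b) + k)
      + (S *v rot (c - b)) \<bullet> (l (midpoint b c) + k) + (S *v rot (a - c)) \<bullet> (l (midpoint c a) + k))"
    unfolding l d_def cross2_def rot_def midpoint_def inner_vec_def matrix_vector_mult_def
    by (simp add: sum_2) (simp add: field_simps)
  also have "sgn d * \<dots> = edge_integral (closed_segment a b) ?f
      + edge_integral (closed_segment b c) ?f + edge_integral (closed_segment c a) ?f"
    by (simp only: 1 2 3) (simp add: right_diff_distrib)
  also have "\<dots> = (\<Sum>e\<in>{closed_segment a b, closed_segment b c, closed_segment c a}. edge_integral e ?f)"
    using ne by (simp add: closed_segment_eq doubleton_eq_iff)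
  also have "{closed_segment a b, closed_segment b c, closed_segment c a} = {e. e edge_of T}"
    unfolding T by (rule edges_of_triangle[OF ind ne, symmetric])
  finally show ?thesis unfolding M_def .
qed

section \<open>The divergence theorem on a mesh\<close>

text \<open>There are no hanging nodes: \<open>T \<inter> T'\<close> is a face of both triangles,
  and a face that meets the relative interior of \<open>e\<close> contains all of
  \<open>e\<close>.\<close>

lemma triangulation_shared_edge:
  assumes tri: "triangulation \<T>" and T: "T \<in> \<T>" "T' \<in> \<T>"
    and e: "e edge_of T" and x: "x \<in> rel_interior e" "x \<in> T'"
  shows "e edge_of T'"
proof -
  have faces: "T \<inter> T' face_of T" "T \<inter> T' face_of T'"
    using tri T unfolding triangulation_def by (metis Int_commute)+
  have "e face_of T" "aff_dim e = 1" using e by (auto simp: edge_of_def)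
  have "x \<in> e" using x(1) rel_interior_subset by blast
  then have "e \<subseteq> T \<inter> T'"
    using subset_of_face_of[OF faces(1), of e] x \<open>e face_of T\<close> face_of_imp_subset
    by (auto simp: disjnt_iff)
  then have "e face_of T \<inter> T'"
    using \<open>e face_of T\<close> face_of_subset by blast
  then show ?thesis
    using faces(2) face_of_trans \<open>aff_dim e = 1\<close> by (auto simp: edge_of_def)
qed

text \<open>A common face with interior points has full dimension, so it would be equal to both
  triangles.\<close>

lemma triangulation_interior_Int:
  fixes T :: "point set"
  assumes tri: "triangulation \<T>" "\<forall>T\<in>\<T>. 2 simplex T" and T: "T \<in> \<T>" "T' \<in> \<T>" "T \<noteq> T'"
  shows "interior (T \<inter> T') = {}"
proof (rule ccontr)
  assume "interior (T \<inter> T') \<noteq> {}"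
  then have "aff_dim (T \<inter> T') = 2" using aff_dim_nonempty_interior by fastforce
  moreover have "T \<inter> T' face_of T" "T \<inter> T' face_of T'"
    using tri T unfolding triangulation_def by (metis Int_commute)+
  moreover have "aff_dim T = 2" "aff_dim T' = 2" "convex T" "convex T'"
    using tri(2) T aff_dim_simplex convex_simplex by blast+
  ultimately have "T \<inter> T' = T" "T \<inter> T' = T'"
    using face_of_aff_dim_lt by (metis less_irrefl)+
  then show False using T by simp
qed

text \<open>One vector serves the whole open edge. The three possible labellings of the vertices are
  absorbed here.\<close>

lemma triangle_edge_normal:
  assumes "2 simplex T" "e edge_of T"
  shows "\<exists>a b n. e = closed_segment a b \<and> a \<noteq> b \<and> rel_interior e = open_segment a b \<and>
    (\<forall>x\<in>open_segment a b. half_plane_at T x n)"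
proof -
  obtain a b c where T: "T = convex hull {a,b,c}" and ind: "\<not> affine_dependent {a,b,c}"
    and ne: "a \<noteq> b" "b \<noteq> c" "a \<noteq> c" and nz: "cross2 (b - a) (c - a) \<noteq> 0"
    using triangle_vertices[OF assms(1)] by metis
  have T': "T = convex hull {b,c,a}" "T = convex hull {c,a,b}"
    by (simp_all add: T insert_commute)
  have nz': "cross2 (c - b) (a - b) \<noteq> 0" "cross2 (a - c) (b - c) \<noteq> 0"
    using nz by (simp_all add: cross2_def algebra_simps)
  have "e \<in> {closed_segment a b, closed_segment b c, closed_segment c a}"
    using edges_of_triangle[OF ind ne] assms(2) T by blast
  then obtain p q r where pqr: "e = closed_segment p q" "T = convex hull {p,q,r}" "p \<noteq> q"
      "cross2 (q - p) (r - p) \<noteq> 0"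
    using T T' nz nz' ne by blast
  have "rel_interior e = open_segment p q"
    using pqr(1,3) by (simp add: rel_interior_closed_segment)
  moreover have "\<forall>x\<in>open_segment p q.
      half_plane_at T x ((- sgn (cross2 (q - p) (r - p)) / dist p q) *\<^sub>R rot (q - p))"
    unfolding pqr(2) using half_plane_at_triangle_edge[OF pqr(4)] by blast
  ultimately show ?thesis using pqr(1,3) by blast
qed

text \<open>An edge shared by two triangles does not contribute, since their normals are opposite;
  at any other edge the mesh coincides locally with its only adjacent triangle.\<close>

lemma edge_flux_sum:
  fixes v :: vfield
  assumes tri: "triangulation \<T>" "\<forall>T\<in>\<T>. 2 simplex T"
    and E: "E \<subseteq> mesh_edges \<T>" "\<Union>E \<subseteq> frontier (\<Union>\<T>)"
    and v: "\<forall>x\<in>frontier (\<Union>\<T>) - \<Union>E. v x = 0"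
    and "e \<in> mesh_edges \<T>"
  shows "(\<Sum>T | T \<in> \<T> \<and> e edge_of T. edge_integral e (\<lambda>x. (S *v outward_normal T x) \<bullet> v x)) =
    (if e \<in> E then edge_integral e (\<lambda>x. (S *v outward_normal (\<Union>\<T>) x) \<bullet> v x) else 0)"
proof -
  obtain T where T: "T \<in> \<T>" "e edge_of T"
    using assms(6) by (auto simp: mesh_edges_def)
  then have "2 simplex T" using tri(2) by blast
  then obtain a b n where e: "e = closed_segment a b" "a \<noteq> b" "rel_interior e = open_segment a b"
    and n: "\<And>x. x \<in> open_segment a b \<Longrightarrow> half_plane_at T x n"
    using triangle_edge_normal[OF _ T(2)] by meson
  have mid: "midpoint a b \<in> open_segment a b" using e(2) by simp
  have sub: "open_segment a b \<subseteq> e" using segment_open_subset_closed e(1) by blast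
  show ?thesis
  proof (cases "\<exists>T'\<in>\<T>. T' \<noteq> T \<and> e edge_of T'")
    case True
    then obtain T' where T': "T' \<in> \<T>" "T' \<noteq> T" "e edge_of T'" by blast
    have opp: "half_plane_at T'' x (- n)"
      if T'': "T'' \<in> \<T>" "T'' \<noteq> T" "e edge_of T''" "x \<in> open_segment a b" for T'' x
    proof -
      have "2 simplex T''" using T'' tri(2) by blast
      then obtain a' b' n' where "rel_interior e = open_segment a' b'"
          "\<And>x. x \<in> open_segment a' b' \<Longrightarrow> half_plane_at T'' x n'"
        using triangle_edge_normal[OF _ T''(3)] by meson
      then have hp: "half_plane_at T'' x n'" using e(3) T''(4) by metis
      have "interior (T \<inter> T'') = {}"
        using triangulation_interior_Int[OF tri T(1) T''(1)] T''(2) by blast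
      then have "n' = - n" by (rule half_plane_at_opposite[OF n[OF T''(4)] hp])
      with hp show ?thesis by simp
    qed
    \<comment> \<open>An edge has at most two triangles: a third one would share the normal
      \<open>- n\<close> with \<open>T'\<close>, although their normals must be opposite.\<close>
    have "T'' = T'" if "T'' \<in> \<T>" "T'' \<noteq> T" "e edge_of T''" for T''
    proof (rule ccontr)
      assume "T'' \<noteq> T'"
      then have "- n = - (- n)"
        using half_plane_at_opposite[OF opp[OF T' mid] opp[OF that mid]]
          triangulation_interior_Int[OF tri T'(1) that(1)] by simp
      then have "n = 0" by (simp add: vec_eq_iff)
      then show False using n[OF mid] by (simp add: half_plane_at_def)
    qed
    then have eq: "{T \<in> \<T>. e edge_of T} = {T, T'}" using T T' by blast
    have "midpoint a b \<in> interior (\<Union>\<T>)"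
      using union_opposite_half_planes_interior[OF n[OF mid] opp[OF T' mid]] T T' by blast
    moreover have "midpoint a b \<in> e" using mid sub by blast
    ultimately have "e \<notin> E" using E(2) unfolding frontier_def by blast
    have "edge_integral e (\<lambda>x. (S *v outward_normal T' x) \<bullet> v x)
        = edge_integral e (\<lambda>x. - ((S *v outward_normal T x) \<bullet> v x))"
      unfolding e(1)
    proof (rule edge_integral_cong[OF e(2)])
      fix x assume x: "x \<in> open_segment a b"
      have "outward_normal T' x = - outward_normal T x"
        using outward_normal_eqI[OF n[OF x]] outward_normal_eqI[OF opp[OF T' x]] by simp
      then have "S *v outward_normal T' x = - (S *v outward_normal T x)"
        using matrix_vector_mult_diff_distrib[of S 0 "outward_normal T x"] by simp
      then show "(S *v outward_normal T' x) \<bullet> v x = - ((S *v outward_normal T x) \<bullet> v x)"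
        by simp
    qed
    then show ?thesis
      using \<open>e \<notin> E\<close> T'(2) by (simp add: eq edge_integral_minus)
  next
    case False
    then have eq: "{T \<in> \<T>. e edge_of T} = {T}" using T by blast
    have other: "T' = T" if "T' \<in> \<T>" "x \<in> T'" "x \<in> open_segment a b" for T' x
      using triangulation_shared_edge[OF tri(1) T(1) that(1) T(2)] that e(3) False by blast
    \<comment> \<open>The remaining triangles form a closed set that avoids \<open>x\<close>; on its
      complement the mesh and \<open>T\<close> agree.\<close>
    have hp: "half_plane_at (\<Union>\<T>) x n" if x: "x \<in> open_segment a b" for x
    proof (rule half_plane_at_cong[OF n[OF x]])
      have "closed (\<Union>(\<T> - {T}))"
        using tri by (intro closed_Union)
          (auto simp: triangulation_def intro!: compact_imp_closed compact_simplex)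
      then show "open (- \<Union>(\<T> - {T}))" by (simp add: open_Compl)
      show "x \<in> - \<Union>(\<T> - {T})" using other x by blast
      show "\<Union>\<T> \<inter> - \<Union>(\<T> - {T}) = T \<inter> - \<Union>(\<T> - {T})" using T by blast
    qed
    show ?thesis
    proof (cases "e \<in> E")
      case True
      have "edge_integral e (\<lambda>x. (S *v outward_normal T x) \<bullet> v x)
          = edge_integral e (\<lambda>x. (S *v outward_normal (\<Union>\<T>) x) \<bullet> v x)"
        unfolding e(1)
        by (rule edge_integral_cong[OF e(2)]) (simp add: outward_normal_eqI[OF n] outward_normal_eqI[OF hp])
      then show ?thesis using True eq by simp
    next
      case False
      have "v x = 0" if x: "x \<in> open_segment a b" for x
      proof -
        \<comment> \<open>The hypothesis on \<open>v\<close> says nothing on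
          \<open>\<Union>E\<close>, so an edge of \<open>E\<close> through \<open>x\<close> has to
          be excluded. It would be an edge of \<open>T\<close> containing \<open>e\<close>, hence
          equal to \<open>e\<close> by dimension.\<close>
        have "x \<notin> \<Union>E"
        proof
          assume "x \<in> \<Union>E"
          then obtain e' T' where e': "x \<in> e'" "e' \<in> E" "T' \<in> \<T>" "e' edge_of T'"
            using E(1) by (force simp: mesh_edges_def)
          then have "T' = T" using other x edge_of_imp_subset by blast
          then have face: "e' face_of T" "aff_dim e' = 1" using e' by (auto simp: edge_of_def)
          have "e face_of T" "aff_dim e = 1" using T by (auto simp: edge_of_def)
          moreover have "e \<subseteq> e'"
            using subset_of_face_of[OF face(1), of e] e(3) e'(1) x edge_of_imp_subset[OF T(2)]
            by (auto simp: disjnt_iff)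
          ultimately have "e face_of e'"
            using face face_of_subset face_of_imp_subset by metis
          then have "e = e'"
            using face_of_aff_dim_lt[of e' e] face \<open>aff_dim e = 1\<close> face_of_imp_convex
              tri(2) T(1) convex_simplex by (metis less_irrefl)
          then show False using False e' by blast
        qed
        then show ?thesis using v half_plane_at_in_frontier[OF hp[OF x]] by blast
      qed
      then have "edge_integral e (\<lambda>x. (S *v outward_normal T x) \<bullet> v x) = edge_integral e (\<lambda>x. 0)"
        unfolding e(1) by (intro edge_integral_cong[OF e(2)]) simp
      then show ?thesis using False eq by simp
    qed
  qed
qed

lemma finite_mesh_edges:
  assumes "triangulation \<T>"
  shows "finite (mesh_edges \<T>)"
proof -
  have "finite {e. e edge_of T}" if T: "T \<in> \<T>" for T
  proof -
    obtain n where "n simplex T" using assms T by (auto simp: triangulation_def)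
    then have "finite {e. e face_of T}" by (intro finite_polytope_faces simplex_imp_polytope)
    then show ?thesis by (rule rev_finite_subset) (auto simp: edge_of_def)
  qed
  moreover have "mesh_edges \<T> = (\<Union>T\<in>\<T>. {e. e edge_of T})" by (auto simp: mesh_edges_def)
  ultimately show ?thesis using assms by (simp add: triangulation_def)
qed

text \<open>Exchanging the two sums groups the fluxes by edge instead of by triangle.\<close>

lemma mesh_flux_sum:
  fixes v :: vfield
  assumes tri: "triangulation \<T>" "\<forall>T\<in>\<T>. 2 simplex T"
    and E: "E \<subseteq> mesh_edges \<T>" "\<Union>E \<subseteq> frontier (\<Union>\<T>)"
    and v: "\<forall>x\<in>frontier (\<Union>\<T>) - \<Union>E. v x = 0"
  shows "(\<Sum>T\<in>\<T>. \<Sum>e | e edge_of T. edge_integral e (\<lambda>x. (S *v outward_normal T x) \<bullet> v x)) =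
    pairing_curve E (\<lambda>x. S *v outward_normal (\<Union>\<T>) x) v"
proof -
  let ?I = "\<lambda>T e. edge_integral e (\<lambda>x. (S *v outward_normal T x) \<bullet> v x)"
  have fin: "finite \<T>" "finite (mesh_edges \<T>)"
    using tri finite_mesh_edges by (auto simp: triangulation_def)
  have "(\<Sum>T\<in>\<T>. \<Sum>e | e edge_of T. ?I T e) = (\<Sum>T\<in>\<T>. \<Sum>e | e \<in> mesh_edges \<T> \<and> e edge_of T. ?I T e)"
    by (intro sum.cong refl) (auto simp: mesh_edges_def)
  also have "\<dots> = (\<Sum>e\<in>mesh_edges \<T>. \<Sum>T | T \<in> \<T> \<and> e edge_of T. ?I T e)"
    using fin by (rule sum.swap_restrict)
  also have "\<dots> = (\<Sum>e\<in>mesh_edges \<T>. if e \<in> E then ?I (\<Union>\<T>) e else 0)"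
    by (intro sum.cong refl edge_flux_sum assms)
  also have "\<dots> = (\<Sum>e\<in>E. ?I (\<Union>\<T>) e)"
    using fin E(1) by (simp add: sum.If_cases Int_absorb1)
  finally show ?thesis by (simp add: pairing_curve_def)
qed

text \<open>The point \<open>x\<close> may lie on the boundary of \<open>U\<close>, where
  derivatives need not be unique in general. Segments from \<open>x\<close> to points of
  \<open>T\<close> stay in \<open>U\<close> and determine the derivative in their directions; as
  \<open>T\<close> has interior points, these directions span the space.\<close>

lemma has_derivative_within_unique_convex:
  fixes f :: "'a::euclidean_space \<Rightarrow> 'b::real_normed_vector"
  assumes D: "(f has_derivative D) (at x within U)" "(f has_derivative D') (at x within U)"
    and T: "convex T" "interior T \<noteq> {}" "T \<subseteq> U" "x \<in> T"
  shows "D = D'"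
proof -
  have lin: "linear D" "linear D'" using D has_derivative_linear by blast+
  have eq: "D (y - x) = D' (y - x)" if y: "y \<in> T" for y
  proof -
    have "((\<lambda>t. f (x + t *\<^sub>R (y - x))) has_vector_derivative F (y - x)) (at 0 within {0..1})"
      if F: "(f has_derivative F) (at x within U)" for F
    proof -
      have "x + t *\<^sub>R (y - x) \<in> T" if "t \<in> {0..1}" for t
        using convexD_alt[OF T(1,4) y, of t] that by (simp add: algebra_simps)
      then have "(\<lambda>t. x + t *\<^sub>R (y - x)) ` {0..1} \<subseteq> U" using T(3) by blast
      from has_derivative_subset[OF F this]
      have "(f has_derivative F) (at (x + 0 *\<^sub>R (y - x)) within (\<lambda>t. x + t *\<^sub>R (y - x)) ` {0..1})"
        by simp
      moreover have "((\<lambda>t. x + t *\<^sub>R (y - x)) has_derivative (\<lambda>t. t *\<^sub>R (y - x))) (at 0 within {0..1})"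
        by (auto intro!: derivative_eq_intros)
      ultimately have "((\<lambda>t. f (x + t *\<^sub>R (y - x))) has_derivative (\<lambda>t. F (t *\<^sub>R (y - x)))) (at 0 within {0..1})"
        by (rule has_derivative_in_compose[rotated])
      then show ?thesis
        using has_derivative_linear[OF F] by (simp add: has_vector_derivative_def linear_cmul)
    qed
    from vector_derivative_unique_within_closed_interval[OF _ _ this[OF D(1), folded box_real] this[OF D(2), folded box_real]]
    show ?thesis by simp
  qed
  obtain y r where y: "r > 0" "ball y r \<subseteq> T"
    using T(2) by (meson ex_in_conv mem_interior)
  \<comment> \<open>Up to the factor \<open>t\<close>, the vector \<open>w\<close> is the difference
    of two directions from \<open>x\<close> to points of the ball inside \<open>T\<close>.\<close>
  have "D w = D' w" for w
  proof -
    obtain t where t: "t > 0" "y + t *\<^sub>R w \<in> ball y r"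
      using y(1) by (rule small_step_in_ball)
    have "D (y - x) = D' (y - x)" "D (y + t *\<^sub>R w - x) = D' (y + t *\<^sub>R w - x)"
      using t y by (auto intro!: eq)
    moreover have "t *\<^sub>R F w = F (y + t *\<^sub>R w - x) - F (y - x)" if "linear F" for F :: "'a \<Rightarrow> 'b"
      using that by (simp add: linear_add linear_diff linear_cmul)
    ultimately have "t *\<^sub>R D w = t *\<^sub>R D' w" using lin by simp
    then show ?thesis using t by simp
  qed
  then show ?thesis by blast
qed

text \<open>Determines the value of the choice operator \<open>frechet_derivative\<close> at every
  point of a closed mesh, including boundary and interface points, where the Taylor operators
  evaluate it.\<close>

lemma frechet_derivative_within_simplex:
  fixes f :: "point \<Rightarrow> 'b::real_normed_vector"
  assumes "(f has_derivative D) (at x within U)" "2 simplex T" "T \<subseteq> U" "x \<in> T"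
  shows "frechet_derivative f (at x within U) = D"
proof (rule has_derivative_within_unique_convex)
  show "(f has_derivative frechet_derivative f (at x within U)) (at x within U)"
    using assms(1) frechet_derivative_works differentiableI by blast
qed (use assms simplex_interior_nonempty convex_simplex in auto)

section \<open>Gradients of affine functions and the bilinear form under constant stress\<close>

lemma grad_affine:
  assumes "\<forall>x\<in>\<Union>\<T>. q x = A *v x + b" "\<forall>T\<in>\<T>. 2 simplex T" "x \<in> \<Union>\<T>"
  shows "grad (\<Union>\<T>) q x = A"
proof -
  have "((\<lambda>x. A *v x + b) has_derivative (\<lambda>x. A *v x)) (at x within \<Union>\<T>)"
    by (intro has_derivative_add_const linear_imp_has_derivative matrix_vector_mul_linear)
  then have "(q has_derivative (\<lambda>x. A *v x)) (at x within \<Union>\<T>)"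
    by (rule has_derivative_transform[rotated 2]) (use assms in blast)+
  then have "frechet_derivative q (at x within \<Union>\<T>) = (\<lambda>x. A *v x)"
    using assms frechet_derivative_within_simplex by blast
  then show ?thesis by (simp add: grad_def)
qed

text \<open>Meant for test functions, which may fail to be differentiable across triangle
  sides.\<close>

lemma grad_interior_affine:
  assumes "linear l" "\<forall>x\<in>T. v x = l x + k" "T \<subseteq> U" "x \<in> interior T"
  shows "grad U v x = matrix l"
proof -
  have "((\<lambda>x. l x + k) has_derivative l) (at x)"
    using assms(1) by (intro has_derivative_add_const linear_imp_has_derivative)
  then have "(v has_derivative l) (at x)"
    by (rule has_derivative_transform_within_open[of _ _ _ _ "interior T"])
      (use assms interior_subset[of T] in auto)
  moreover have "at x within U = at x"
    using assms by (meson at_within_interior interior_mono subsetD)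
  ultimately show ?thesis using frechet_derivative_at[of v l x] by (simp add: grad_def)
qed

text \<open>A symmetric matrix is orthogonal to the skew part of \<open>B\<close>. The strain of a
  test function can thus be replaced by its full gradient, as \<open>triangle_green\<close>
  requires.\<close>

lemma inner_sym_part:
  assumes "transpose S = S"
  shows "S \<bullet> sym_part B = S \<bullet> B"
proof -
  have "S $ 1 $ 2 = transpose S $ 2 $ 1" by (simp add: transpose_def)
  also have "\<dots> = S $ 2 $ 1" using assms by simp
  finally show ?thesis
    by (simp add: sym_part_def inner_vec_def sum_2 transpose_def field_simps)
qed

lemma transpose_stress_sym_part: "transpose (stress lam mu (sym_part B)) = stress lam mu (sym_part B)"
  by (simp add: stress_def sym_part_def transpose_def mat_def vec_eq_iff forall_2)

lemma bilinear_a_affine: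
  fixes q v :: vfield
  assumes tri: "triangulation \<T>" "\<forall>T\<in>\<T>. 2 simplex T"
    and E: "E \<subseteq> mesh_edges \<T>" "\<Union>E \<subseteq> frontier (\<Union>\<T>)"
    and q: "\<forall>x\<in>\<Union>\<T>. q x = A *v x + b" and v: "v \<in> V_h \<T> E"
  shows "bilinear_a \<T> lam mu q v =
    pairing_curve E (\<lambda>x. stress lam mu (sym_part A) *v outward_normal (\<Union>\<T>) x) v"
proof -
  define S where "S = stress lam mu (sym_part A)"
  have "\<exists>l k. linear l \<and> (\<forall>x\<in>T. v x = l x + k)" if "T \<in> \<T>" for T
    using v that by (auto simp: V_h_def P1_def affine_on_def)
  then obtain l k where lk: "\<And>T. T \<in> \<T> \<Longrightarrow> linear (l T)" "\<And>T x. T \<in> \<T> \<Longrightarrow> x \<in> T \<Longrightarrow> v x = l T x + k T"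
    by metis
  \<comment> \<open>The integrand is known, and constant, only in the interior of \<open>T\<close>;
    the frontier is discarded as a null set.\<close>
  have "((\<lambda>x. S \<bullet> strain (\<Union>\<T>) v x) has_integral measure lborel T * (S \<bullet> matrix (l T))) T"
    if T: "T \<in> \<T>" for T
  proof (rule has_integral_spike)
    have "2 simplex T" using T tri(2) by blast
    then have "compact T" "convex T" by (auto simp: compact_simplex convex_simplex)
    then show "negligible (frontier T)" by (simp add: negligible_convex_frontier)
    have "((\<lambda>x::point. 1::real) has_integral measure lborel T) T"
      using \<open>compact T\<close> by (intro has_integral_measure_lborel borel_compact emeasure_compact_finite)
    from has_integral_mult_left[OF this, of "S \<bullet> matrix (l T)"]
    show "((\<lambda>x. S \<bullet> matrix (l T)) has_integral measure lborel T * (S \<bullet> matrix (l T))) T"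
      by simp
    fix x assume "x \<in> T - frontier T"
    then have "x \<in> interior T"
      using \<open>compact T\<close> by (simp add: frontier_def compact_imp_closed)
    then have "grad (\<Union>\<T>) v x = matrix (l T)"
      using T lk by (intro grad_interior_affine[of _ T _ "k T"]) auto
    then show "S \<bullet> strain (\<Union>\<T>) v x = S \<bullet> matrix (l T)"
      by (simp add: strain_def S_def inner_sym_part transpose_stress_sym_part)
  qed
  moreover have "pairwise (\<lambda>T T'. negligible (T \<inter> T')) \<T>"
  proof (rule pairwiseI)
    fix T T' assume T: "T \<in> \<T>" "T' \<in> \<T>" "T \<noteq> T'"
    then have "convex T" "convex T'" using tri(2) by (blast intro: convex_simplex)+
    then have "convex (T \<inter> T')" by (rule convex_Int)
    then show "negligible (T \<inter> T')"
      using triangulation_interior_Int[OF tri T] by (subst negligible_convex_interior)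
  qed
  moreover have "finite \<T>" using tri by (simp add: triangulation_def)
  ultimately have "integral (\<Union>\<T>) (\<lambda>x. S \<bullet> strain (\<Union>\<T>) v x) = (\<Sum>T\<in>\<T>. measure lborel T * (S \<bullet> matrix (l T)))"
    by (intro integral_unique has_integral_Union)
  also have "\<dots> = (\<Sum>T\<in>\<T>. \<Sum>e | e edge_of T. edge_integral e (\<lambda>x. (S *v outward_normal T x) \<bullet> v x))"
    using tri(2) lk by (intro sum.cong refl triangle_green) auto
  also have "\<dots> = pairing_curve E (\<lambda>x. S *v outward_normal (\<Union>\<T>) x) v"
    using v by (intro mesh_flux_sum assms) (simp add: V_h_def dirichlet_part_def)
  also have "integral (\<Union>\<T>) (\<lambda>x. S \<bullet> strain (\<Union>\<T>) v x) = bilinear_a \<T> lam mu q v"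
    unfolding bilinear_a_def S_def
    by (intro integral_cong) (simp add: strain_def grad_affine[OF q tri(2)])
  finally show ?thesis by (simp add: S_def)
qed

section \<open>Recovery of linear functions\<close>

lemma nodes_subset_Union: "nodes \<T> \<subseteq> \<Union>\<T>"
  by (auto simp: nodes_def extreme_point_of_def)

lemma layer_subset: "layer \<S> z i \<subseteq> \<S>"
  by (cases i) auto

lemma quadratics_affine: "(\<lambda>x. a \<bullet> x + c) \<in> quadratics"
proof -
  have "\<forall>x. a \<bullet> x + c = c + a$1 * x$1 + a$2 * x$2 + 0 * (x$1)^2 + 0 * (x$1 * x$2) + 0 * (x$2)^2"
    by (simp add: inner_vec_def sum_2)
  then show ?thesis unfolding quadratics_def by blast
qed

text \<open>The affine function is itself a quadratic and has residual zero, so it is a minimizer;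
  well-posedness makes it the only one.\<close>

lemma fitted_poly_affine:
  assumes wp: "recovery_well_posed \<S>" and z: "z \<in> nodes \<S>"
    and v: "\<forall>x\<in>\<Union>\<S>. v x = a \<bullet> x + c"
  shows "fitted_poly \<S> v z = (\<lambda>x. a \<bullet> x + c)"
  unfolding fitted_poly_def
proof (rule the1_equality)
  show "\<exists>!p. least_squares_fit (nodes (patch \<S> z)) v p"
    using wp z by (simp add: recovery_well_posed_def)
  have "nodes (patch \<S> z) \<subseteq> \<Union>\<S>"
    unfolding patch_def using nodes_subset_Union layer_subset by (meson Union_mono subset_trans)
  then have "(\<Sum>z\<in>nodes (patch \<S> z). ((a \<bullet> z + c) - v z)\<^sup>2) = 0"
    using v by (intro sum.neutral) auto
  then show "least_squares_fit (nodes (patch \<S> z)) v (\<lambda>x. a \<bullet> x + c)"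
    unfolding least_squares_fit_def is_arg_min_def
    using quadratics_affine by (simp add: not_less sum_nonneg)
qed

lemma gradient_at_affine: "gradient_at (\<lambda>x. a \<bullet> x + c) z = a"
proof -
  have "((\<lambda>x. a \<bullet> x + c) has_derivative (\<lambda>x. a \<bullet> x)) (at z)"
    by (intro has_derivative_add_const linear_imp_has_derivative)
      (simp add: linearI inner_add_right)
  from frechet_derivative_at[OF this, symmetric] show ?thesis
    by (simp add: gradient_at_def inner_axis vec_eq_iff)
qed

text \<open>On each triangle the level set of the affine function is convex and contains the
  vertices, hence their hull.\<close>

lemma P1_constant_nodes:
  assumes w: "w \<in> P1 \<S>" and \<S>: "\<forall>T\<in>\<S>. 2 simplex T"
    and nodes: "\<forall>z\<in>nodes \<S>. w z = g" and x: "x \<in> \<Union>\<S>"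
  shows "w x = g"
proof -
  obtain T where T: "T \<in> \<S>" "x \<in> T" using x by blast
  obtain l k where l: "linear l" "\<And>x. x \<in> T \<Longrightarrow> w x = l x + k"
    using w T by (auto simp: P1_def affine_on_def)
  obtain C where C: "\<not> affine_dependent C" "T = convex hull C"
    using \<S> T(1) unfolding simplex_def by blast
  have "C \<subseteq> {x. l x = g - k}"
  proof
    fix z assume z: "z \<in> C"
    then have "z \<in> nodes \<S>" "z \<in> T"
      using C T(1) extreme_point_of_convex_hull_affine_independent hull_inc
      by (auto simp: nodes_def)
    then show "z \<in> {x. l x = g - k}" using nodes l(2)[of z] by (simp add: eq_diff_eq)
  qed
  moreover have "convex {x. l x = g - k}"
    using convex_linear_vimage[OF l(1) convex_singleton[of "g - k"]] by (simp add: vimage_def)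
  ultimately have "T \<subseteq> {x. l x = g - k}"
    using C(2) hull_minimal by blast
  then show ?thesis using l(2) T(2) by auto
qed

text \<open>The constant function shows that the \<open>SOME\<close> has a witness; any other
  witness agrees with it on the mesh.\<close>

lemma nodal_interpolant_constant:
  assumes "\<forall>T\<in>\<S>. 2 simplex T" "\<forall>z\<in>nodes \<S>. f z = g" "x \<in> \<Union>\<S>"
  shows "nodal_interpolant \<S> f x = g"
proof -
  have "affine_on T (\<lambda>x. g)" for T
    unfolding affine_on_def by (intro exI[of _ "\<lambda>x. 0"] exI[of _ g]) (simp add: linear_zero)
  then have "\<exists>w. w \<in> P1 \<S> \<and> (\<forall>z\<in>nodes \<S>. w z = f z)"
    using assms(2) by (intro exI[of _ "\<lambda>x. g"]) (simp add: P1_def)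
  then have "nodal_interpolant \<S> f \<in> P1 \<S> \<and> (\<forall>z\<in>nodes \<S>. nodal_interpolant \<S> f z = f z)"
    unfolding nodal_interpolant_def by (rule someI_ex)
  then show ?thesis using P1_constant_nodes assms by metis
qed

lemma recovered_tensor_affine:
  assumes "recovery_well_posed \<S>" "\<forall>T\<in>\<S>. 2 simplex T"
    and v: "\<forall>x\<in>\<Union>\<S>. v x = A *v x + b" and "x \<in> \<Union>\<S>"
  shows "recovered_tensor \<S> v x = A"
proof -
  have "recovered_grad \<S> (\<lambda>y. v y $ i) x = A $ i" for i
  proof -
    have "\<forall>x\<in>\<Union>\<S>. v x $ i = A $ i \<bullet> x + b $ i"
      using v by (simp add: matrix_vector_mult_def inner_vec_def)
    from fitted_poly_affine[OF assms(1) _ this]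
    have "\<forall>z\<in>nodes \<S>. gradient_at (fitted_poly \<S> (\<lambda>y. v y $ i) z) z = A $ i"
      by (simp add: gradient_at_affine)
    then show ?thesis
      unfolding recovered_grad_def using assms by (intro nodal_interpolant_constant)
  qed
  then show ?thesis by (simp add: recovered_tensor_def vec_eq_iff)
qed

lemma taylor_tensor_constant:
  assumes J: "\<forall>y\<in>\<Union>\<S>. J y = A" and "\<forall>T\<in>\<S>. 2 simplex T" "\<phi> x \<in> \<Union>\<S>"
  shows "taylor_tensor (\<Union>\<S>) \<phi> J x = A"
proof -
  have "(J has_derivative (\<lambda>h. 0)) (at (\<phi> x) within \<Union>\<S>)"
    using assms by (intro has_derivative_transform[OF _ _ has_derivative_const]) auto
  then have "frechet_derivative J (at (\<phi> x) within \<Union>\<S>) = (\<lambda>h. 0)"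
    using assms frechet_derivative_within_simplex by blast
  moreover have "J (\<phi> x) = A" using assms by blast
  ultimately show ?thesis by (simp add: taylor_tensor_def tensor_partial_def vec_eq_iff)
qed

text \<open>The end points of an interface edge are interface nodes, so the triangle carrying the
  edge lies in the strip. The recovered gradient is therefore available on the whole
  interface.\<close>

lemma mesh_edges_subset_strip:
  assumes "\<forall>T\<in>\<T>. 2 simplex T" "E \<subseteq> mesh_edges \<T>"
  shows "\<Union>E \<subseteq> \<Union>(strip \<T> E)"
proof
  fix x assume "x \<in> \<Union>E"
  then obtain e T where e: "x \<in> e" "e \<in> E" "T \<in> \<T>" "e edge_of T"
    using assms(2) by (force simp: mesh_edges_def)
  then obtain a b where ab: "e = closed_segment a b"
    using triangle_edge_normal assms(1) by metis
  then have "a \<in> nodes E" using e(2) unfolding nodes_def by (auto simp: extreme_point_of_segment intro!: bexI[of _ e])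
  moreover have "e \<subseteq> T" using e(4) by (rule edge_of_imp_subset)
  ultimately have "T \<in> strip \<T> E" using e(3) ab by (auto simp: strip_def)
  then show "x \<in> \<Union>(strip \<T> E)" using \<open>e \<subseteq> T\<close> e(1) by blast
qed

section \<open>Trial spaces and pairings on the interface\<close>

lemma V_trial_affine:
  assumes "\<forall>x\<in>\<Union>\<T>. q x = A *v x + b" "\<forall>x\<in>dirichlet_part \<T> E. g x = q x"
  shows "q \<in> V_trial \<T> E g"
proof -
  have "affine_on T q" if "T \<in> \<T>" for T
    unfolding affine_on_def using assms(1) that
    by (intro exI[of _ "(*v) A"] exI[of _ b]) auto
  moreover have "continuous_on (\<Union>\<T>) (\<lambda>x. A *v x + b)"
    by (intro continuous_intros linear_continuous_on matrix_vector_mul_bounded_linear)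
  then have "continuous_on (\<Union>\<T>) q" using assms(1) by (metis (no_types, lifting) continuous_on_cong)
  ultimately show ?thesis using assms(2) by (simp add: V_trial_def P1_def)
qed

lemma pairing_curve_cong:
  assumes "E \<subseteq> mesh_edges \<T>" "\<forall>T\<in>\<T>. 2 simplex T" and eq: "\<And>x. x \<in> \<Union>E \<Longrightarrow> f x \<bullet> w x = g x \<bullet> w' x"
  shows "pairing_curve E f w = pairing_curve E g w'"
  unfolding pairing_curve_def
proof (rule sum.cong[OF refl])
  fix e assume e: "e \<in> E"
  then obtain T where "T \<in> \<T>" "e edge_of T" using assms(1) by (auto simp: mesh_edges_def)
  then obtain a b where ab: "e = closed_segment a b" "a \<noteq> b"
    using triangle_edge_normal assms(2) by metis
  have "open_segment a b \<subseteq> \<Union>E" using ab(1) e segment_open_subset_closed by blast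
  then show "edge_integral e (\<lambda>x. f x \<bullet> w x) = edge_integral e (\<lambda>x. g x \<bullet> w' x)"
    unfolding ab(1) using eq by (intro edge_integral_cong[OF ab(2)]) blast
qed

lemma pairing_curve_zero:
  assumes "E \<subseteq> mesh_edges \<T>" "\<forall>T\<in>\<T>. 2 simplex T" "\<forall>x\<in>\<Union>E. f x \<bullet> w x = 0"
  shows "pairing_curve E f w = 0"
proof -
  have "pairing_curve E f w = pairing_curve E (\<lambda>x. 0) w"
    using assms(3) by (intro pairing_curve_cong[OF assms(1,2)]) auto
  then show ?thesis by (simp add: pairing_curve_def)
qed

theorem proposition1:
  fixes \<Omega>s \<Omega>m :: "(real^2) set"
    and \<T>s \<T>m Es Em :: "(real^2) set set"
    and \<phi>sm \<phi>ms :: "real^2 \<Rightarrow> real^2"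
    and C lams mus lamm mum :: real
    and fs fm gs gm qs qm :: "real^2 \<Rightarrow> real^2"
    and A :: "real^2^2" and b :: "real^2"
  assumes "lipschitz_domain \<Omega>s" and "lipschitz_domain \<Omega>m"
    and "\<exists>g. arc g \<and> path_image g = frontier \<Omega>s \<inter> frontier \<Omega>m"
    and "mesh_of \<T>s \<Omega>s" and "mesh_of \<T>m \<Omega>m"
    and "discretizes Es \<T>s (frontier \<Omega>s \<inter> frontier \<Omega>m)"
    and "discretizes Em \<T>m (frontier \<Omega>s \<inter> frontier \<Omega>m)"
    and "\<phi>sm ` \<Union>Es \<subseteq> \<Union>Em" and "\<phi>ms ` \<Union>Em \<subseteq> \<Union>Es"
    and "\<forall>x\<in>\<Union>Es. dist x (\<phi>sm x) \<le> C * max (mesh_size \<T>s) (mesh_size \<T>m)"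
    and "\<forall>x\<in>\<Union>Em. dist x (\<phi>ms x) \<le> C * max (mesh_size \<T>s) (mesh_size \<T>m)"
    and "recovery_well_posed (strip \<T>s Es)"
    and "(lams, mus) = (lamm, mum)"
    and "(fs, fm) = ((\<lambda>x. 0), (\<lambda>x. 0))"
    and "\<forall>x\<in>\<Union>\<T>s. qs x = A *v x + b"
    and "\<forall>x\<in>\<Union>\<T>m. qm x = A *v x + b"
    and "\<forall>x\<in>dirichlet_part \<T>s Es. gs x = qs x"
    and "\<forall>x\<in>dirichlet_part \<T>m Em. gm x = qm x"
  shows "solves_coupled_problem \<T>s Es \<T>m Em \<phi>sm \<phi>ms lams mus lamm mum fs fm gs gm qs qm"
proof -
  note qs = assms(15) and qm = assms(16)
  have tri: "triangulation \<T>s" "\<forall>T\<in>\<T>s. 2 simplex T" "triangulation \<T>m" "\<forall>T\<in>\<T>m. 2 simplex T"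
    using assms(4,5) by (auto simp: mesh_of_def)
  have edges: "Es \<subseteq> mesh_edges \<T>s" "\<Union>Es \<subseteq> frontier (\<Union>\<T>s)"
      "Em \<subseteq> mesh_edges \<T>m" "\<Union>Em \<subseteq> frontier (\<Union>\<T>m)"
    using assms(6,7) by (simp_all add: discretizes_def)
  have strip: "\<Union>Es \<subseteq> \<Union>(strip \<T>s Es)" "strip \<T>s Es \<subseteq> \<T>s"
    using mesh_edges_subset_strip[OF tri(2) edges(1)] by (auto simp: strip_def)
  have strip_affine: "\<forall>T\<in>strip \<T>s Es. 2 simplex T" "\<forall>x\<in>\<Union>(strip \<T>s Es). qs x = A *v x + b"
    using strip(2) tri(2) qs by blast+
  have sub: "\<Union>Es \<subseteq> \<Union>\<T>s" "\<Union>Em \<subseteq> \<Union>\<T>m"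
    using strip mesh_edges_subset_strip[OF tri(4) edges(3)] by (auto simp: strip_def)
  have zero: "pairing_domain \<T> (\<lambda>x. 0) v = 0" for \<T> v
    by (simp add: pairing_domain_def)
  have lame: "lamm = lams" "mum = mus" and force: "fs = (\<lambda>x. 0)" "fm = (\<lambda>x. 0)"
    using assms(13,14) by auto
  have "bilinear_a \<T>s lams mus qs v = 0" if v: "v \<in> V_h0 \<T>s Es" for v
  proof -
    \<comment> \<open>These test functions vanish on the interface as well, so the flux term left by
      the divergence theorem is zero.\<close>
    have "v \<in> V_h \<T>s Es" "\<forall>x\<in>\<Union>Es. v x = 0" using v edges(2) by (auto simp: V_h0_def)
    then show ?thesis
      using bilinear_a_affine[OF tri(1,2) edges(1,2) qs] pairing_curve_zero[OF edges(1) tri(2)] by simp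
  qed
  moreover have "pairing_curve Es (\<lambda>x. taylor_vec (\<Union>\<T>s) \<phi>sm qs x - qm (\<phi>sm x)) w = 0" for w
  proof (rule pairing_curve_zero[OF edges(1) tri(2)], rule ballI)
    fix x assume x: "x \<in> \<Union>Es"
    then have "x \<in> \<Union>\<T>s" "\<phi>sm x \<in> \<Union>\<T>m" using sub assms(8) by blast+
    then have "taylor_vec (\<Union>\<T>s) \<phi>sm qs x = qs x + A *v (\<phi>sm x - x)"
      using grad_affine[OF qs tri(2)] by (simp add: taylor_vec_def)
    moreover have "qs x = A *v x + b" "qm (\<phi>sm x) = A *v \<phi>sm x + b"
      using qs qm \<open>x \<in> \<Union>\<T>s\<close> \<open>\<phi>sm x \<in> \<Union>\<T>m\<close> by blast+
    ultimately have "taylor_vec (\<Union>\<T>s) \<phi>sm qs x = qm (\<phi>sm x)"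
      by (simp add: matrix_vector_mult_diff_distrib)
    then show "(taylor_vec (\<Union>\<T>s) \<phi>sm qs x - qm (\<phi>sm x)) \<bullet> w x = 0" by simp
  qed
  moreover have "bilinear_a \<T>m lamm mum qm v = pairing_curve Em
      (\<lambda>x. extended_stress (strip \<T>s Es) \<phi>ms lams mus qs x *v outward_normal (\<Union>\<T>m) x) v"
    if v: "v \<in> V_h \<T>m Em" for v
  proof -
    have "extended_stress (strip \<T>s Es) \<phi>ms lams mus qs x = stress lams mus (sym_part A)"
      if x: "x \<in> \<Union>Em" for x
    proof -
      \<comment> \<open>The recovered tensor is known to be \<open>A\<close> only on the strip, so
        the expansion point has to lie there.\<close>
      have "\<phi>ms x \<in> \<Union>(strip \<T>s Es)" using x assms(9) strip(1) by blast
      then have "taylor_tensor (\<Union>(strip \<T>s Es)) \<phi>ms (recovered_tensor (strip \<T>s Es) qs) x = A"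
        using recovered_tensor_affine[OF assms(12) strip_affine]
        by (intro taylor_tensor_constant strip_affine(1)) auto
      then show ?thesis by (simp add: extended_stress_def extended_strain_def)
    qed
    then have "pairing_curve Em (\<lambda>x. extended_stress (strip \<T>s Es) \<phi>ms lams mus qs x *v outward_normal (\<Union>\<T>m) x) v
        = pairing_curve Em (\<lambda>x. stress lams mus (sym_part A) *v outward_normal (\<Union>\<T>m) x) v"
      by (intro pairing_curve_cong[OF edges(3) tri(4)]) simp
    \<comment> \<open>Equal Lame parameters identify the stress of \<open>qm\<close> with the stress
      extended from the other side.\<close>
    then show ?thesis
      using bilinear_a_affine[OF tri(3,4) edges(3,4) qm v] lame by simp
  qed
  ultimately show ?thesis
    unfolding solves_coupled_problem_def force zero
    using V_trial_affine[OF qs assms(17)] V_trial_affine[OF qm assms(18)] by simp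
qed

end
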